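(* There is an absolute constant $C$ such that every finite Sidon set $\mathcal{A}$ with $k$ elements satisfies \[ \operatorname{diam}(\mathcal{A})\ge k^2-1.96365\,k^{3/2}-Ck. \]
   Context: A Sidon set is a set $\mathcal{A}$ of integers such that the only solutions of $a-b=c-d$ with $a,b,c,d\in\mathcal{A}$ are the trivial ones ($a=b,c=d$ or $a=c,b=d$). For a finite set $\mathcal{A}$, $\operatorname{diam}(\mathcal{A})=\max\mathcal{A}-\min\mathcal{A}$. *)

theory Defs
  imports Complex_Main
begin

definition sidon :: "int set \<Rightarrow> bool" where
  "sidon A \<longleftrightarrow>
     (\<forall>a\<in>A. \<forall>b\<in>A. \<forall>c\<in>A. \<forall>d\<in>A.
        a - b = c - d \<longrightarrow> (a = b \<and> c = d) \<or> (a = c \<and> b = d))"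

(* Only meaningful for finite nonempty sets: Max and Min are unspecified on the empty set. *)
definition diam :: "int set \<Rightarrow> int" where
  "diam A = Max A - Min A"

end

theory Submission
  imports Defs "HOL-Analysis.Analysis"
begin

text \<open>
  The classical window count is refined in two ways. The elements are counted with the weight
  \<open>2\<close> on a window of length \<open>T\<close> and weight \<open>1\<close> on the next one, and the
  Cauchy--Schwarz inequality is applied against a sequence adapted to this weight instead of a
  constant: it is close to \<open>1/3\<close>, with an alternating geometric correction at the right end.
  With \<open>m\<close> windows this yields \<open>9 k\<^sup>2 \<le> (m + 27/16) (5 k + 9 T)\<close>; taking
  \<open>m\<close> about \<open>2 \<surd>k\<close> and \<open>T\<close> about \<open>diam A / m\<close> gives the
  constant \<open>10/9 + 27/32 < 1.96365\<close>.
\<close>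

section \<open>Weighted energy bound for Sidon sets\<close>

lemma sidon_difference_inj:
  assumes "sidon A"
  shows "inj_on (\<lambda>(p, q). p - q) {(p, q) \<in> A \<times> A. p \<noteq> q}"
proof (rule inj_onI, clarify)
  fix a b c d
  assume "a \<in> A" "b \<in> A" "c \<in> A" "d \<in> A" "a \<noteq> b" "a - b = c - d"
  then show "a = c \<and> b = d"
    using assms unfolding sidon_def by blast
qed

text \<open>Expanding the square turns the left side into a sum of autocorrelations of
  \<open>W\<close> over pairs from \<open>A\<close>. The diagonal pairs give the first term. Off the
  diagonal each difference occurs at most once, so those pairs contribute at most the total mass of
  the autocorrelation, which is the square of the mass of \<open>W\<close>.\<close>

lemma sidon_weighted_energy:
  fixes W :: "int \<Rightarrow> real"
  assumes "finite A" "sidon A" "finite S" "finite I"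
    and W_nonneg: "\<And>y. W y \<ge> 0" and W_supp: "\<And>y. y \<notin> S \<Longrightarrow> W y = 0"
  shows "(\<Sum>i\<in>I. (\<Sum>p\<in>A. W (i - p))\<^sup>2) \<le> card A * (\<Sum>y\<in>S. (W y)\<^sup>2) + (\<Sum>y\<in>S. W y)\<^sup>2"
proof -
  define \<phi> where "\<phi> d = (\<Sum>u\<in>S. W u * W (u + d))" for d
  define D where "D = {(p, q) \<in> A \<times> A. p \<noteq> q}"
  have finD: "finite D"
    using assms(1) unfolding D_def by (auto intro: finite_subset[of _ "A \<times> A"])
  have sum_le: "(\<Sum>y\<in>X. h y) \<le> (\<Sum>y\<in>S. h y)"
    if "finite X" "\<And>y. h y \<ge> 0" "\<And>y. y \<notin> S \<Longrightarrow> h y = 0" for X and h :: "int \<Rightarrow> real"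
  proof -
    have "(\<Sum>y\<in>X. h y) = (\<Sum>y\<in>X \<inter> S. h y)"
      using that by (intro sum.mono_neutral_right) auto
    also have "\<dots> \<le> (\<Sum>y\<in>S. h y)"
      using that assms(3) by (intro sum_mono2) auto
    finally show ?thesis .
  qed
  \<comment> \<open>Only an inequality, since the translate of \<open>I\<close> by \<open>p\<close>
    may miss part of \<open>S\<close>.\<close>
  have pair: "(\<Sum>i\<in>I. W (i - p) * W (i - q)) \<le> \<phi> (p - q)" for p q
  proof -
    have "(\<Sum>i\<in>I. W (i - p) * W (i - q)) = (\<Sum>u\<in>(\<lambda>i. i - p) ` I. W u * W (u + (p - q)))"
      by (subst sum.reindex) (auto simp: inj_on_def)
    also have "\<dots> \<le> \<phi> (p - q)"
      unfolding \<phi>_def using assms by (intro sum_le) auto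
    finally show ?thesis .
  qed
  have "(\<Sum>i\<in>I. (\<Sum>p\<in>A. W (i - p))\<^sup>2) = (\<Sum>i\<in>I. \<Sum>p\<in>A. \<Sum>q\<in>A. W (i - p) * W (i - q))"
    by (simp add: power2_eq_square sum_product)
  also have "\<dots> = (\<Sum>p\<in>A. \<Sum>i\<in>I. \<Sum>q\<in>A. W (i - p) * W (i - q))"
    by (rule sum.swap)
  also have "\<dots> = (\<Sum>p\<in>A. \<Sum>q\<in>A. \<Sum>i\<in>I. W (i - p) * W (i - q))"
    by (intro sum.cong refl sum.swap)
  also have "\<dots> \<le> (\<Sum>p\<in>A. \<Sum>q\<in>A. \<phi> (p - q))"
    by (intro sum_mono pair)
  also have "\<dots> = (\<Sum>(p, q)\<in>A \<times> A. \<phi> (p - q))"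
    by (simp add: sum.cartesian_product)
  also have "A \<times> A = (\<lambda>p. (p, p)) ` A \<union> D"
    unfolding D_def by auto
  also have "(\<Sum>(p, q)\<in>(\<lambda>p. (p, p)) ` A \<union> D. \<phi> (p - q))
      = (\<Sum>(p, q)\<in>(\<lambda>p. (p, p)) ` A. \<phi> (p - q)) + (\<Sum>(p, q)\<in>D. \<phi> (p - q))"
    using assms(1) finD by (intro sum.union_disjoint) (auto simp: D_def)
  also have "(\<Sum>(p, q)\<in>(\<lambda>p. (p, p)) ` A. \<phi> (p - q)) = card A * \<phi> 0"
    by (subst sum.reindex) (auto simp: inj_on_def)
  also have "\<phi> 0 = (\<Sum>y\<in>S. (W y)\<^sup>2)"
    by (simp add: \<phi>_def power2_eq_square)
  \<comment> \<open>With \<open>u\<close> fixed, the points \<open>u + (p - q)\<close> are distinct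
    as \<open>(p, q)\<close> runs over \<open>D\<close>, so the inner sum samples \<open>W\<close>
    at most once per point.\<close>
  also have "(\<Sum>(p, q)\<in>D. \<phi> (p - q)) = (\<Sum>u\<in>S. W u * (\<Sum>(p, q)\<in>D. W (u + (p - q))))"
    unfolding \<phi>_def case_prod_unfold sum_distrib_left by (rule sum.swap)
  also have "\<dots> \<le> (\<Sum>u\<in>S. W u * (\<Sum>y\<in>S. W y))"
  proof (intro sum_mono mult_left_mono W_nonneg)
    fix u
    let ?f = "(\<lambda>d. u + d) \<circ> (\<lambda>(p, q). p - q) :: int \<times> int \<Rightarrow> int"
    have "inj_on ?f D"
      unfolding D_def by (rule comp_inj_on[OF sidon_difference_inj[OF assms(2)]]) (simp add: inj_on_def)
    then have "sum W (?f ` D) = sum (W \<circ> ?f) D"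
      by (rule sum.reindex)
    then have "(\<Sum>(p, q)\<in>D. W (u + (p - q))) = (\<Sum>y\<in>?f ` D. W y)"
      by (simp add: comp_def case_prod_unfold)
    also have "\<dots> \<le> (\<Sum>y\<in>S. W y)"
      using finD assms by (intro sum_le) auto
    finally show "(\<Sum>(p, q)\<in>D. W (u + (p - q))) \<le> (\<Sum>y\<in>S. W y)" .
  qed
  also have "\<dots> = (\<Sum>y\<in>S. W y)\<^sup>2"
    by (simp add: power2_eq_square sum_distrib_right)
  finally show ?thesis by simp
qed

section \<open>The step weight and its dual sequence\<close>

definition step_weight :: "nat \<Rightarrow> int \<Rightarrow> real" where
  "step_weight T y = (if 0 \<le> y \<and> y < int T then 2 else if int T \<le> y \<and> y < 2 * int T then 1 else 0)"

lemma sum_step_weight: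
  fixes h :: "int \<Rightarrow> real \<Rightarrow> real"
  shows "(\<Sum>y\<in>{0..<2 * int T}. h y (step_weight T y))
       = (\<Sum>y<T. h (int y) 2 + h (int (y + T)) 1)"
proof -
  have "(\<Sum>y\<in>{0..<2 * int T}. h y (step_weight T y)) = (\<Sum>y\<in>int ` {0..<T + T}. h y (step_weight T y))"
    by (simp add: image_int_atLeastLessThan)
  also have "\<dots> = (\<Sum>y\<in>{0..<T + T}. h (int y) (step_weight T (int y)))"
    by (subst sum.reindex) auto
  also have "\<dots> = (\<Sum>y\<in>{0..<T}. h (int y) (step_weight T (int y)))
                 + (\<Sum>y\<in>{T..<T + T}. h (int y) (step_weight T (int y)))"
    by (rule sum.atLeastLessThan_concat[symmetric]) auto
  also have "(\<Sum>y\<in>{T..<T + T}. h (int y) (step_weight T (int y)))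
           = (\<Sum>y\<in>{0..<T}. h (int (y + T)) (step_weight T (int (y + T))))"
    using sum.shift_bounds_nat_ivl[of "\<lambda>y. h (int y) (step_weight T (int y))" 0 T T] by simp
  finally show ?thesis
    by (simp add: step_weight_def sum.distrib lessThan_atLeast0)
qed

text \<open>The recurrence 2 x_j + x_(j+1) = 1 has general solution 1/3 + c (-1/2)^(L - j). For
  large \<open>L\<close> its sum of squares over j \<le> L is close to (L + 1)/9 + 4c/9 + 4c^2/3,
  which is smallest at c = -1/6.\<close>

definition dual_weight :: "nat \<Rightarrow> nat \<Rightarrow> real" where
  "dual_weight L j = 1/3 - 1/6 * (-1/2) ^ (L - j)"

lemma dual_weight_rec:
  assumes "j < L"
  shows "2 * dual_weight L j + dual_weight L (Suc j) = 1"
proof -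
  have "L - j = Suc (L - Suc j)"
    using assms by simp
  then show ?thesis
    by (simp add: dual_weight_def)
qed

text \<open>The sum is (L + 2/3)/9 up to geometrically small terms. For L \<ge> 4 these add at most
  1/(16 * 27) = (1/48)/9, and 2/3 + 1/48 = 11/16.\<close>

lemma sum_dual_weight_squares:
  assumes "L \<ge> 4"
  shows "(\<Sum>j<Suc L. (dual_weight L j)\<^sup>2) \<le> (L + 11/16) / 9"
proof -
  have closed: "(\<Sum>j<Suc n. (1/3 - 1/6 * (-1/2) ^ j)\<^sup>2)
      = (n + 2/3) / 9 - (-1/2) ^ n / 27 - ((-1/2) ^ n)\<^sup>2 / (108::real)" for n
    by (induction n) (simp_all add: power2_eq_square field_simps)
  have "\<bar>(-1/2) ^ L\<bar> = (1/2 :: real) ^ L"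
    by (simp add: power_abs)
  also have "\<dots> \<le> (1/2) ^ 4"
    using assms by (intro power_decreasing) auto
  finally have "- ((-1/2) ^ L) \<le> (1/16 :: real)"
    using abs_ge_minus_self[of "(-1/2 :: real) ^ L"] unfolding power4_eq_xxxx by linarith
  moreover have "0 \<le> ((-1/2 :: real) ^ L)\<^sup>2"
    by simp
  moreover have "(\<Sum>j<Suc L. (dual_weight L j)\<^sup>2) = (\<Sum>j<Suc L. (1/3 - 1/6 * (-1/2) ^ j)\<^sup>2)"
    by (subst sum.nat_diff_reindex[symmetric]) (simp add: dual_weight_def)
  ultimately show ?thesis
    unfolding closed add_divide_distrib by linarith
qed

text \<open>The positions q + y and q + y + T lie in consecutive blocks of length \<open>T\<close>
  and carry weights 2 and 1, so by the recurrence each y < T contributes exactly 1, wherever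
  \<open>q\<close> sits inside its block.\<close>

lemma dual_weight_step_weight:
  assumes "0 \<le> q" "q < int (m * T)" "T > 0"
  shows "(\<Sum>i<(m + 2) * T. dual_weight (Suc m) (i div T) * step_weight T (int i - q)) = T"
proof -
  obtain q' where q: "q = int q'" and q': "q' < m * T"
    using assms by (metis nonneg_int_cases of_nat_less_iff)
  let ?g = "\<lambda>x. dual_weight (Suc m) (nat x div T)"
  have "(\<Sum>i<(m + 2) * T. dual_weight (Suc m) (i div T) * step_weight T (int i - q))
      = (\<Sum>x\<in>int ` {0..<(m + 2) * T}. ?g x * step_weight T (x - q))"
    by (subst sum.reindex) (auto simp: lessThan_atLeast0)
  \<comment> \<open>The two blocks beyond the first \<open>m\<close> leave room for the whole
    support of the translated weight.\<close>
  also have "\<dots> = (\<Sum>x\<in>{q..<q + 2 * int T}. ?g x * step_weight T (x - q))"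
    using assms(1,2) unfolding image_int_atLeastLessThan
    by (intro sum.mono_neutral_right) (auto simp: step_weight_def algebra_simps)
  also have "\<dots> = (\<Sum>y\<in>{0..<2 * int T}. ?g (q + y) * step_weight T y)"
    by (rule sum.reindex_bij_witness[of _ "\<lambda>y. q + y" "\<lambda>x. x - q"]) auto
  also have "\<dots> = (\<Sum>y<T. ?g (q + int y) * 2 + ?g (q + int (y + T)) * 1)"
    by (rule sum_step_weight)
  also have "\<dots> = (\<Sum>y<T. 1)"
  proof (rule sum.cong)
    fix y assume "y \<in> {..<T}"
    then have "q' + y < Suc m * T"
      using q' by simp
    then have "(q' + y) div T < Suc m"
      using assms(3) by (simp add: div_less_iff_less_mult)
    moreover have "nat (q + int y) = q' + y" "nat (q + int (y + T)) = (q' + y) + T"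
      using q by auto
    ultimately show "?g (q + int y) * 2 + ?g (q + int (y + T)) * 1 = 1"
      using dual_weight_rec assms(3) by (simp add: mult.commute)
  qed simp
  finally show ?thesis by simp
qed

section \<open>The window inequality by Cauchy-Schwarz\<close>

lemma sidon_window_inequality:
  assumes "finite A" "sidon A" "A \<subseteq> {lo..<lo + int (m * T)}" "T > 0" "m \<ge> 3"
  shows "9 * (real (card A))\<^sup>2 \<le> (m + 27/16) * (5 * card A + 9 * T)"
proof -
  define k where "k = real (card A)"
  define N where "N = (m + 2) * T"
  define g where "g i = dual_weight (Suc m) (i div T)" for i
  define F where "F i = (\<Sum>p\<in>A. step_weight T (lo + int i - p))" for i
  have "(\<Sum>i<N. g i * F i) = (\<Sum>p\<in>A. \<Sum>i<N. g i * step_weight T (lo + int i - p))"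
    unfolding F_def sum_distrib_left by (rule sum.swap)
  also have "\<dots> = (\<Sum>p\<in>A. real T)"
  proof (rule sum.cong)
    fix p assume "p \<in> A"
    then show "(\<Sum>i<N. g i * step_weight T (lo + int i - p)) = T"
      using dual_weight_step_weight[of "p - lo" m T] assms(3,4)
      unfolding g_def N_def by (auto simp: algebra_simps)
  qed simp
  finally have dual: "(\<Sum>i<N. g i * F i) = k * T"
    by (simp add: k_def)
  \<comment> \<open>\<open>g\<close> is constant on blocks of length \<open>T\<close>, so its norm
    reduces to that of the dual sequence with L = m + 1; this is where m \<ge> 3 and 27/16 = 1 +
    11/16 come from.\<close>
  have "(\<Sum>i<N. (g i)\<^sup>2) = (\<Sum>j<m + 2. \<Sum>i\<in>{j * T..<j * T + T}. (g i)\<^sup>2)"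
    unfolding N_def by (rule sum.nat_group[symmetric])
  also have "\<dots> = (\<Sum>j<m + 2. \<Sum>i\<in>{j * T..<j * T + T}. (dual_weight (Suc m) j)\<^sup>2)"
  proof (intro sum.cong refl)
    fix j i assume "i \<in> {j * T..<j * T + T}"
    then have "i div T = j"
      by (intro div_nat_eqI) (auto simp: algebra_simps)
    then show "(g i)\<^sup>2 = (dual_weight (Suc m) j)\<^sup>2"
      by (simp add: g_def)
  qed
  also have "\<dots> = T * (\<Sum>j<Suc (Suc m). (dual_weight (Suc m) j)\<^sup>2)"
    by (simp add: sum_distrib_left algebra_simps)
  also have "\<dots> \<le> T * ((Suc m + 11/16) / 9)"
    using assms(5) by (intro mult_left_mono sum_dual_weight_squares) auto
  finally have g_norm: "(\<Sum>i<N. (g i)\<^sup>2) \<le> T * ((m + 27/16) / 9)"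
    by (simp add: algebra_simps)
  have "(\<Sum>i<N. (F i)\<^sup>2) = (\<Sum>i\<in>(\<lambda>i. lo + int i) ` {..<N}. (\<Sum>p\<in>A. step_weight T (i - p))\<^sup>2)"
    unfolding F_def by (subst sum.reindex) (auto simp: inj_on_def)
  also have "\<dots> \<le> card A * (\<Sum>y\<in>{0..<2 * int T}. (step_weight T y)\<^sup>2)
      + (\<Sum>y\<in>{0..<2 * int T}. step_weight T y)\<^sup>2"
    using assms(1,2) by (intro sidon_weighted_energy) (auto simp: step_weight_def)
  \<comment> \<open>Here 5 = 2^2 + 1^2 and 9 = (2 + 1)^2.\<close>
  also have "\<dots> = T * (5 * k + 9 * T)"
    using sum_step_weight[of "\<lambda>_ w. w\<^sup>2" T] sum_step_weight[of "\<lambda>_ w. w" T]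
    by (simp add: k_def power2_eq_square algebra_simps)
  finally have F_norm: "(\<Sum>i<N. (F i)\<^sup>2) \<le> T * (5 * k + 9 * T)" .
  have "(k * T)\<^sup>2 \<le> (\<Sum>i<N. (g i)\<^sup>2) * (\<Sum>i<N. (F i)\<^sup>2)"
    using Cauchy_Schwarz_ineq_sum[of g F "{..<N}"] by (simp add: dual)
  also have "\<dots> \<le> (T * ((m + 27/16) / 9)) * (T * (5 * k + 9 * T))"
    by (intro mult_mono g_norm F_norm sum_nonneg) auto
  finally have "(real T)\<^sup>2 * (9 * k\<^sup>2) \<le> (real T)\<^sup>2 * ((m + 27/16) * (5 * k + 9 * T))"
    by (simp add: power2_eq_square field_simps)
  then show ?thesis
    using assms(4) by (simp add: k_def)
qed

section \<open>Choice of parameters and the final estimate\<close>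

theorem theorem3:
  "\<exists>C::real. \<forall>A::int set. finite A \<and> A \<noteq> {} \<and> sidon A \<longrightarrow>
     real_of_int (diam A) \<ge>
       real (card A) ^ 2 - 1.96365 * real (card A) powr (3/2) - C * real (card A)"
proof (intro exI allI impI, elim conjE)
  fix A :: "int set"
  assume A: "finite A" "A \<noteq> {}" "sidon A"
  define k where "k = real (card A)"
  define s where "s = sqrt k"
  \<comment> \<open>Balancing 5mk/9 against 27k^2/(16m) would give m about 1.743 \<open>s\<close>;
    the simpler 2 \<open>s\<close> already beats the required constant. The added 1 ensures m \<ge>
    3 even when s = 1.\<close>
  define m where "m = nat \<lceil>2 * s\<rceil> + 1"
  define n where "n = nat (diam A)"
  define T where "T = n div m + 1"
  have "card A \<ge> 1"
    using A by (simp add: Suc_leI card_gt_0_iff)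
  then have k1: "k \<ge> 1"
    by (simp add: k_def)
  then have s1: "s \<ge> 1" and s2: "s\<^sup>2 = k"
    by (auto simp: s_def)
  have k32: "k powr (3/2) = s * k"
  proof -
    have "k powr (3/2) = k powr (1 + 1/2)"
      by simp
    also have "\<dots> = s * k"
      unfolding powr_add using k1 by (simp add: s_def powr_half_sqrt)
    finally show ?thesis .
  qed
  have m_ge: "2 * s \<le> m" and m_le: "m \<le> 2 * s + 2" and "m \<ge> 3"
    using s1 unfolding m_def by linarith+
  have diam_n: "diam A = int n"
    using A unfolding n_def diam_def by simp
  \<comment> \<open>The added 1 in \<open>T\<close> makes this strict, so that the half-open
    interval contains \<open>Max A\<close>.\<close>
  have "n < m * T"
    using \<open>m \<ge> 3\<close> dividend_less_times_div[of m n] unfolding T_def by (simp add: algebra_simps)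
  then have "A \<subseteq> {Min A..<Min A + int (m * T)}"
  proof (intro subsetI)
    fix x assume "x \<in> A"
    then have "Min A \<le> x" "x \<le> Max A"
      using A by auto
    then show "x \<in> {Min A..<Min A + int (m * T)}"
      using diam_n \<open>n < m * T\<close> unfolding diam_def atLeastLessThan_iff by linarith
  qed
  then have main: "9 * k\<^sup>2 \<le> (m + 27/16) * (5 * k + 9 * T)"
    using sidon_window_inequality[of A "Min A" m T] A \<open>m \<ge> 3\<close> by (simp add: T_def k_def)
  have T_le: "real m * real T \<le> n + m"
    unfolding of_nat_mult[symmetric] of_nat_add[symmetric] of_nat_le_iff
    by (simp add: T_def algebra_simps)
  show "real_of_int (diam A) \<ge> real (card A) ^ 2 - 1.96365 * real (card A) powr (3/2) - 8 * real (card A)"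
  proof (cases "real n \<ge> k\<^sup>2")
    case True
    moreover have "1.96365 * k powr (3/2) \<ge> 0"
      by simp
    ultimately show ?thesis
      using k1 unfolding diam_n of_int_of_nat_eq k_def[symmetric] by linarith
  next
    case False
    \<comment> \<open>Since n < k^2 in this case, T - 1 \<le> n/m \<le> k^2/(2s) = sk/2.\<close>
    have "2 * s * (real T - 1) \<le> m * (real T - 1)"
      using m_ge by (intro mult_right_mono) (auto simp: T_def)
    also have "\<dots> \<le> n"
      using T_le by (simp add: algebra_simps)
    also have "\<dots> \<le> s * (s * k)"
      using False by (simp add: power2_eq_square flip: s2)
    finally have "s * (2 * (real T - 1)) \<le> s * (s * k)"
      by (simp add: algebra_simps)
    then have T_le': "T \<le> s * k / 2 + 1"
      using s1 by simp
    have "real m * k \<le> (2 * s + 2) * k"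
      using m_le k1 by (intro mult_right_mono) auto
    \<comment> \<open>These absorb the lower-order terms: replacing \<open>s\<close> and 1 by
      \<open>k\<close> leaves a total coefficient of 69.625/9 < 8 for \<open>k\<close>, while that
      of \<open>s * k\<close> is 10/9 + 27/32.\<close>
    moreover have "s \<le> k" and "k \<le> s * k"
      using s1 k1 self_le_power[of s 2] unfolding s2 by simp_all
    ultimately have "k\<^sup>2 - 1.96365 * (s * k) - 8 * k \<le> n"
      using main T_le T_le' m_le k1 by (simp add: algebra_simps)
    then show ?thesis
      by (simp add: diam_n k32 flip: k_def)
  qed
qed

end
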